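(* Let $\mathbf{A},\mathbf{B},\mathbf{C}$ be categories, let $\kappa=(\mathrm{get}^\kappa,\mathrm{put}^\kappa)$ be an ala-lens from $\mathbf{A}$ to $\mathbf{B}$ with parameter category $\mathbf{P}$, and let $\ell=(\mathrm{get}^\ell,\mathrm{put}^\ell)$ be an ala-lens from $\mathbf{B}$ to $\mathbf{C}$ with parameter category $\mathbf{Q}$. Let $\kappa;\ell$ be their sequential composition (an ala-lens from $\mathbf{A}$ to $\mathbf{C}$ with parameter category $\mathbf{P}\times\mathbf{Q}$). If $\kappa$ and $\ell$ are both well-behaved, then $\kappa;\ell$ is well-behaved.
   Context: Notation: for a category $\mathbf{X}$, $|\mathbf{X}|$ is its class of objects; composition of arrows is written in diagrammatic order $u;u'$. Parameterized functor: given categories $\mathbf{S},\mathbf{T},\mathbf{P}$, a functor $\mathrm{get}:\mathbf{P}\to[\mathbf{S},\mathbf{T}]$ into the category of functors $\mathbf{S}\to\mathbf{T}$ and natural transformations. For $p\in|\mathbf{P}|$ write $\mathrm{get}_p=\mathrm{get}(p)$ and $S_p=\mathrm{get}_p(S)$; for $e:p\to p'$ in $\mathbf{P}$, $\mathrm{get}_e=\mathrm{get}(e):\mathrm{get}_p\Rightarrow\mathrm{get}_{p'}$, with component $e_S=\mathrm{get}_e(S):S_p\to S_{p'}$. For an arrow $u:S\to S'$ in $\mathbf{S}$ write $u.\mathrm{get}_e:=e_S;\mathrm{get}_{p'}(u)=\mathrm{get}_p(u);e_{S'}:S_p\to S'_{p'}$. Ala-lens (asymmetric learning delta lens with amendment)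 from $\mathbf{S}$ to $\mathbf{T}$ with parameter category $\mathbf{P}$: a pair $(\mathrm{get},\mathrm{put})$ where $\mathrm{get}:\mathbf{P}\to[\mathbf{S},\mathbf{T}]$ is a parameterized functor and $\mathrm{put}$ consists of three families of operations indexed by $(p,S)\in|\mathbf{P}|\times|\mathbf{S}|$: for every arrow $v:S_p\to T'$ in $\mathbf{T}$ they return $\mathrm{put}^{\mathrm{upd}}_{p,S}(v):p\to p'$ in $\mathbf{P}$, $\mathrm{put}^{\mathrm{req}}_{p,S}(v):S\to S'$ in $\mathbf{S}$, and $\mathrm{put}^{\mathrm{self}}_{p,S}(v)=:v^@:T'\to \mathrm{get}_{p'}(S')$ in $\mathbf{T}$ (the amendment), where $p'$ and $S'$ are the codomains of the first two arrows (so the codomain of $v;v^@$ equals $\mathrm{get}_{p'}$ applied to the codomain of $\mathrm{put}^{\mathrm{req}}_{p,S}(v)$). Well-behaved ala-lens: for all $p\in|\mathbf{P}|$, $S\in|\mathbf{S}|$, $v:S_p\to T'$: (Stability) $\mathrm{put}^{\mathrm{upd}}_{p,S}(\mathrm{id}_{S_p})=\mathrm{id}_p$, $\mathrm{put}^{\mathrm{req}}_{p,S}(\mathrm{id}_{S_p})=\mathrm{id}_S$, $\mathrm{put}^{\mathrm{self}}_{p,S}(\mathrm{id}_{S_p})=\mathrm{id}_{S_p}$; (Putget) $(\mathrm{put}^{\mathrm{req}}_{p,S}(v)).\mathrm{get}_e=v;v^@$ where $e=\mathrm{put}^{\mathrm{upd}}_{p,S}(v)$ and $v^@=\mathrm{put}^{\mathrm{self}}_{p,S}(v)$.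 Sequential composition $\kappa;\ell$: parameter category $\mathbf{P}\times\mathbf{Q}$; $\mathrm{get}^{\kappa;\ell}_{(p,q)}=\mathrm{get}^\kappa_p;\mathrm{get}^\ell_q$ (first $\mathrm{get}^\kappa_p$, then $\mathrm{get}^\ell_q$), and for $(e,h):(p,q)\to(p',q')$, $\mathrm{get}^{\kappa;\ell}_{(e,h)}$ is the horizontal (Godement) composite of $\mathrm{get}^\kappa_e$ and $\mathrm{get}^\ell_h$. For $A\in|\mathbf{A}|$, $(p,q)$, and $w:\mathrm{get}^\ell_q(\mathrm{get}^\kappa_p(A))\to C'$ in $\mathbf{C}$, put $B=\mathrm{get}^\kappa_p(A)$, $h=\mathrm{put}^{\ell,\mathrm{upd}}_{q,B}(w):q\to q'$, $v=\mathrm{put}^{\ell,\mathrm{req}}_{q,B}(w):B\to B'$, $w^@=\mathrm{put}^{\ell,\mathrm{self}}_{q,B}(w)$, then $e=\mathrm{put}^{\kappa,\mathrm{upd}}_{p,A}(v):p\to p'$, $u=\mathrm{put}^{\kappa,\mathrm{req}}_{p,A}(v)$, $v^@=\mathrm{put}^{\kappa,\mathrm{self}}_{p,A}(v)$; and define $\mathrm{put}^{\kappa;\ell,\mathrm{upd}}_{(p,q),A}(w)=(e,h)$, $\mathrm{put}^{\kappa;\ell,\mathrm{req}}_{(p,q),A}(w)=u$, $\mathrm{put}^{\kappa;\ell,\mathrm{self}}_{(p,q),A}(w)=w^@;\mathrm{get}^\ell_{q'}(v^@)$. *)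

theory Defs
  imports "HOL-Library.FuncSet"
begin

text \<open>
  Objects and arrows are carrier sets in two types. \<open>Comp C f g\<close> is composition in
  diagrammatic order, first \<open>f\<close>, then \<open>g\<close>; it is meaningful only if
  \<open>Cod C f = Dom C g\<close>.
\<close>

record ('o, 'a) cat =
  Obj :: "'o set"
  Arr :: "'a set"
  Dom :: "'a \<Rightarrow> 'o"
  Cod :: "'a \<Rightarrow> 'o"
  Ident :: "'o \<Rightarrow> 'a"
  Comp :: "'a \<Rightarrow> 'a \<Rightarrow> 'a"

definition Hom :: "('o, 'a) cat \<Rightarrow> 'o \<Rightarrow> 'o \<Rightarrow> 'a set" where
  "Hom C x y = {f \<in> Arr C. Dom C f = x \<and> Cod C f = y}"

locale category =
  fixes C :: "('o, 'a) cat"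
  assumes dom_in: "f \<in> Arr C \<Longrightarrow> Dom C f \<in> Obj C"
    and cod_in: "f \<in> Arr C \<Longrightarrow> Cod C f \<in> Obj C"
    and ident_in: "x \<in> Obj C \<Longrightarrow> Ident C x \<in> Hom C x x"
    and comp_in: "f \<in> Hom C x y \<Longrightarrow> g \<in> Hom C y z \<Longrightarrow> Comp C f g \<in> Hom C x z"
    and comp_ident_left: "f \<in> Hom C x y \<Longrightarrow> Comp C (Ident C x) f = f"
    and comp_ident_right: "f \<in> Hom C x y \<Longrightarrow> Comp C f (Ident C y) = f"
    and comp_assoc: "f \<in> Hom C w x \<Longrightarrow> g \<in> Hom C x y \<Longrightarrow> h \<in> Hom C y z \<Longrightarrow>
      Comp C (Comp C f g) h = Comp C f (Comp C g h)"

definition prod_cat :: "('o1, 'a1) cat \<Rightarrow> ('o2, 'a2) cat \<Rightarrow> ('o1 \<times> 'o2, 'a1 \<times> 'a2) cat" where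
  "prod_cat P Q = \<lparr>
     Obj = Obj P \<times> Obj Q,
     Arr = Arr P \<times> Arr Q,
     Dom = (\<lambda>(e, h). (Dom P e, Dom Q h)),
     Cod = (\<lambda>(e, h). (Cod P e, Cod Q h)),
     Ident = (\<lambda>(p, q). (Ident P p, Ident Q q)),
     Comp = (\<lambda>(e, h) (e', h'). (Comp P e e', Comp Q h h'))\<rparr>"

text \<open>
  A functor is an object of a functor category, so equality of functors has to be equality
  of HOL values. Therefore the object and arrow maps of a functor, and the components of a
  natural transformation, are required to be \<open>undefined\<close> outside the carriers.
\<close>

record ('o1, 'a1, 'o2, 'a2) func =
  omap :: "'o1 \<Rightarrow> 'o2"
  amap :: "'a1 \<Rightarrow> 'a2"

locale is_functor = S: category S + T: category T
  for S :: "('o1, 'a1) cat" and T :: "('o2, 'a2) cat" +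
  fixes F :: "('o1, 'a1, 'o2, 'a2) func"
  assumes omap_ext: "omap F \<in> extensional (Obj S)"
    and amap_ext: "amap F \<in> extensional (Arr S)"
    and omap_in: "x \<in> Obj S \<Longrightarrow> omap F x \<in> Obj T"
    and amap_in: "f \<in> Hom S x y \<Longrightarrow> amap F f \<in> Hom T (omap F x) (omap F y)"
    and amap_ident: "x \<in> Obj S \<Longrightarrow> amap F (Ident S x) = Ident T (omap F x)"
    and amap_comp: "f \<in> Hom S x y \<Longrightarrow> g \<in> Hom S y z \<Longrightarrow>
      amap F (Comp S f g) = Comp T (amap F f) (amap F g)"

record ('o1, 'a1, 'o2, 'a2) ntrans =
  src :: "('o1, 'a1, 'o2, 'a2) func"
  trg :: "('o1, 'a1, 'o2, 'a2) func"
  cmpt :: "'o1 \<Rightarrow> 'a2"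

locale is_ntrans = src: is_functor S T "src \<alpha>" + trg: is_functor S T "trg \<alpha>"
  for S :: "('o1, 'a1) cat" and T :: "('o2, 'a2) cat"
    and \<alpha> :: "('o1, 'a1, 'o2, 'a2) ntrans" +
  assumes cmpt_ext: "cmpt \<alpha> \<in> extensional (Obj S)"
    and cmpt_in: "x \<in> Obj S \<Longrightarrow> cmpt \<alpha> x \<in> Hom T (omap (src \<alpha>) x) (omap (trg \<alpha>) x)"
    and natural: "f \<in> Hom S x y \<Longrightarrow>
      Comp T (cmpt \<alpha> x) (amap (trg \<alpha>) f) = Comp T (amap (src \<alpha>) f) (cmpt \<alpha> y)"

definition functor_cat ::
  "('o1, 'a1) cat \<Rightarrow> ('o2, 'a2) cat \<Rightarrow>
   (('o1, 'a1, 'o2, 'a2) func, ('o1, 'a1, 'o2, 'a2) ntrans) cat" where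
  "functor_cat S T = \<lparr>
     Obj = {F. is_functor S T F},
     Arr = {\<alpha>. is_ntrans S T \<alpha>},
     Dom = src,
     Cod = trg,
     Ident = (\<lambda>F. \<lparr>src = F, trg = F, cmpt = (\<lambda>x\<in>Obj S. Ident T (omap F x))\<rparr>),
     Comp = (\<lambda>\<alpha> \<beta>. \<lparr>src = src \<alpha>, trg = trg \<beta>,
       cmpt = (\<lambda>x\<in>Obj S. Comp T (cmpt \<alpha> x) (cmpt \<beta> x))\<rparr>)\<rparr>"

definition functor_comp ::
  "('o1, 'a1) cat \<Rightarrow> ('o1, 'a1, 'o2, 'a2) func \<Rightarrow> ('o2, 'a2, 'o3, 'a3) func \<Rightarrow>
   ('o1, 'a1, 'o3, 'a3) func" where
  "functor_comp S F G = \<lparr>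
     omap = (\<lambda>x\<in>Obj S. omap G (omap F x)),
     amap = (\<lambda>f\<in>Arr S. amap G (amap F f))\<rparr>"

text \<open>
  The Godement composite of \<open>\<alpha> : F \<Rightarrow> F'\<close> and \<open>\<beta> : G \<Rightarrow> G'\<close>, where \<open>F\<close>, \<open>F'\<close> start at \<open>S\<close>
  and \<open>G\<close>, \<open>G'\<close> end at \<open>U\<close>: its component at \<open>x\<close> is \<open>\<beta>\<close> at \<open>F x\<close>, followed by \<open>G'\<close> of
  \<open>\<alpha>\<close> at \<open>x\<close>.
\<close>

definition godement ::
  "('o1, 'a1) cat \<Rightarrow> ('o3, 'a3) cat \<Rightarrow> ('o1, 'a1, 'o2, 'a2) ntrans \<Rightarrow>
   ('o2, 'a2, 'o3, 'a3) ntrans \<Rightarrow> ('o1, 'a1, 'o3, 'a3) ntrans" where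
  "godement S U \<alpha> \<beta> = \<lparr>
     src = functor_comp S (src \<alpha>) (src \<beta>),
     trg = functor_comp S (trg \<alpha>) (trg \<beta>),
     cmpt = (\<lambda>x\<in>Obj S.
       Comp U (cmpt \<beta> (omap (src \<alpha>) x)) (amap (trg \<beta>) (cmpt \<alpha> x)))\<rparr>"

record ('so, 'sa, 'to, 'ta, 'po, 'pa) lens =
  get :: "('po, 'pa, ('so, 'sa, 'to, 'ta) func, ('so, 'sa, 'to, 'ta) ntrans) func"
  put_upd :: "'po \<Rightarrow> 'so \<Rightarrow> 'ta \<Rightarrow> 'pa"
  put_req :: "'po \<Rightarrow> 'so \<Rightarrow> 'ta \<Rightarrow> 'sa"
  put_self :: "'po \<Rightarrow> 'so \<Rightarrow> 'ta \<Rightarrow> 'ta"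

abbreviation get_at ::
  "('so, 'sa, 'to, 'ta, 'po, 'pa) lens \<Rightarrow> 'po \<Rightarrow> ('so, 'sa, 'to, 'ta) func" where
  "get_at l p \<equiv> omap (get l) p"

abbreviation get_along ::
  "('so, 'sa, 'to, 'ta, 'po, 'pa) lens \<Rightarrow> 'pa \<Rightarrow> ('so, 'sa, 'to, 'ta) ntrans" where
  "get_along l e \<equiv> amap (get l) e"

text \<open>
  For \<open>u : X \<rightarrow> X'\<close> in \<open>S\<close> and \<open>e : p \<rightarrow> p'\<close> in \<open>P\<close>, the arrow written \<open>u.get_e\<close>, that is,
  \<open>e_X\<close> followed by \<open>get_p'(u)\<close>.
\<close>

definition get_arr ::
  "('so, 'sa) cat \<Rightarrow> ('to, 'ta) cat \<Rightarrow> ('po, 'pa) cat \<Rightarrow>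
   ('so, 'sa, 'to, 'ta, 'po, 'pa) lens \<Rightarrow> 'pa \<Rightarrow> 'sa \<Rightarrow> 'ta" where
  "get_arr S T P l e u =
     Comp T (cmpt (get_along l e) (Dom S u)) (amap (get_at l (Cod P e)) u)"

text \<open>
  The \<open>put\<close> operations are constrained only at arguments \<open>p\<close>, \<open>X\<close>, \<open>v\<close> with \<open>v\<close> an arrow out of
  \<open>get_p(X)\<close>.
\<close>

locale ala_lens = S: category S + T: category T + P: category P +
  get: is_functor P "functor_cat S T" "get l"
  for S :: "('so, 'sa) cat" and T :: "('to, 'ta) cat" and P :: "('po, 'pa) cat"
    and l :: "('so, 'sa, 'to, 'ta, 'po, 'pa) lens" +
  assumes put_upd_in:
    "\<lbrakk>p \<in> Obj P; X \<in> Obj S; v \<in> Arr T; Dom T v = omap (get_at l p) X\<rbrakk> \<Longrightarrow>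
      put_upd l p X v \<in> Arr P \<and> Dom P (put_upd l p X v) = p"
    and put_req_in:
    "\<lbrakk>p \<in> Obj P; X \<in> Obj S; v \<in> Arr T; Dom T v = omap (get_at l p) X\<rbrakk> \<Longrightarrow>
      put_req l p X v \<in> Arr S \<and> Dom S (put_req l p X v) = X"
    and put_self_in:
    "\<lbrakk>p \<in> Obj P; X \<in> Obj S; v \<in> Arr T; Dom T v = omap (get_at l p) X\<rbrakk> \<Longrightarrow>
      put_self l p X v \<in> Hom T (Cod T v)
        (omap (get_at l (Cod P (put_upd l p X v))) (Cod S (put_req l p X v)))"

locale well_behaved_ala_lens = ala_lens S T P l
  for S :: "('so, 'sa) cat" and T :: "('to, 'ta) cat" and P :: "('po, 'pa) cat"
    and l :: "('so, 'sa, 'to, 'ta, 'po, 'pa) lens" +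
  assumes stability_upd:
    "\<lbrakk>p \<in> Obj P; X \<in> Obj S\<rbrakk> \<Longrightarrow> put_upd l p X (Ident T (omap (get_at l p) X)) = Ident P p"
    and stability_req:
    "\<lbrakk>p \<in> Obj P; X \<in> Obj S\<rbrakk> \<Longrightarrow> put_req l p X (Ident T (omap (get_at l p) X)) = Ident S X"
    and stability_self:
    "\<lbrakk>p \<in> Obj P; X \<in> Obj S\<rbrakk> \<Longrightarrow>
      put_self l p X (Ident T (omap (get_at l p) X)) = Ident T (omap (get_at l p) X)"
    and putget:
    "\<lbrakk>p \<in> Obj P; X \<in> Obj S; v \<in> Arr T; Dom T v = omap (get_at l p) X\<rbrakk> \<Longrightarrow>
      get_arr S T P l (put_upd l p X v) (put_req l p X v) = Comp T v (put_self l p X v)"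

definition seq_lens ::
  "('ao, 'aa) cat \<Rightarrow> ('co, 'ca) cat \<Rightarrow> ('po, 'pa) cat \<Rightarrow> ('qo, 'qa) cat \<Rightarrow>
   ('ao, 'aa, 'bo, 'ba, 'po, 'pa) lens \<Rightarrow> ('bo, 'ba, 'co, 'ca, 'qo, 'qa) lens \<Rightarrow>
   ('ao, 'aa, 'co, 'ca, 'po \<times> 'qo, 'pa \<times> 'qa) lens" where
  "seq_lens A C P Q k l = \<lparr>
     get = \<lparr>
       omap = (\<lambda>(p, q) \<in> Obj (prod_cat P Q). functor_comp A (get_at k p) (get_at l q)),
       amap = (\<lambda>(e, h) \<in> Arr (prod_cat P Q). godement A C (get_along k e) (get_along l h))\<rparr>,
     put_upd = (\<lambda>(p, q) X w.
       let Y = omap (get_at k p) X;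
           h = put_upd l q Y w;
           v = put_req l q Y w;
           e = put_upd k p X v
       in (e, h)),
     put_req = (\<lambda>(p, q) X w.
       let Y = omap (get_at k p) X;
           v = put_req l q Y w
       in put_req k p X v),
     put_self = (\<lambda>(p, q) X w.
       let Y = omap (get_at k p) X;
           h = put_upd l q Y w;
           v = put_req l q Y w
       in Comp C (put_self l q Y w) (amap (get_at l (Cod Q h)) (put_self k p X v)))\<rparr>"

end

theory Submission
  imports Defs
begin

text \<open>
  Horizontal composition of natural transformations respects identities and vertical
  composition, so the composite \<open>get\<close> is again a functor. Putget for the composite is
  associativity, functoriality of \<open>get_q'\<close> and the two Putget laws:
  \<open>(h_B; get_q'(e_A)); get_q'(get_p'(u)) = h_B; get_q'(v; v\<^sup>@) = (w; w\<^sup>@); get_q'(v\<^sup>@)\<close>.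
\<close>

section \<open>Product and functor categories\<close>

lemma HomI: "f \<in> Arr C \<Longrightarrow> Dom C f = x \<Longrightarrow> Cod C f = y \<Longrightarrow> f \<in> Hom C x y"
  and Hom_Arr: "f \<in> Hom C x y \<Longrightarrow> f \<in> Arr C"
  and Hom_Dom: "f \<in> Hom C x y \<Longrightarrow> Dom C f = x"
  and Hom_Cod: "f \<in> Hom C x y \<Longrightarrow> Cod C f = y"
  by (simp_all add: Hom_def)

lemma (in category) Hom_Obj:
  assumes "f \<in> Hom C x y"
  shows "x \<in> Obj C" and "y \<in> Obj C"
  using assms dom_in cod_in by (auto simp: Hom_def)

section \<open>Product categories\<close>

lemma prod_cat_simps [simp]:
  "Obj (prod_cat P Q) = Obj P \<times> Obj Q"
  "Arr (prod_cat P Q) = Arr P \<times> Arr Q"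
  "Dom (prod_cat P Q) (e, h) = (Dom P e, Dom Q h)"
  "Cod (prod_cat P Q) (e, h) = (Cod P e, Cod Q h)"
  "Ident (prod_cat P Q) (p, q) = (Ident P p, Ident Q q)"
  "Comp (prod_cat P Q) (e, h) (e', h') = (Comp P e e', Comp Q h h')"
  by (simp_all add: prod_cat_def)

text \<open>The objects are explicit pairs, so typing in the product splits into two independent
  typings. Later proofs therefore case-split objects into pairs before simplifying.\<close>

lemma Hom_prod_cat [simp]:
  "Hom (prod_cat P Q) (p, q) (p', q') = Hom P p p' \<times> Hom Q q q'"
  by (auto simp: Hom_def)

lemma category_prod_cat:
  assumes "category P" and "category Q"
  shows "category (prod_cat P Q)"
proof -
  interpret P: category P by fact
  interpret Q: category Q by fact
  show ?thesis
  proof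
    fix f x y g z assume "f \<in> Hom (prod_cat P Q) x y" "g \<in> Hom (prod_cat P Q) y z"
    then show "Comp (prod_cat P Q) f g \<in> Hom (prod_cat P Q) x z"
      by (cases x; cases y; cases z) (auto intro: P.comp_in Q.comp_in)
  next
    fix f w x g y h z
    assume "f \<in> Hom (prod_cat P Q) w x" "g \<in> Hom (prod_cat P Q) x y"
      "h \<in> Hom (prod_cat P Q) y z"
    then show "Comp (prod_cat P Q) (Comp (prod_cat P Q) f g) h =
        Comp (prod_cat P Q) f (Comp (prod_cat P Q) g h)"
      by (cases w; cases x; cases y; cases z) (auto intro: P.comp_assoc Q.comp_assoc)
  next
    fix f x y assume "f \<in> Hom (prod_cat P Q) x y"
    then show "Comp (prod_cat P Q) (Ident (prod_cat P Q) x) f = f"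
      and "Comp (prod_cat P Q) f (Ident (prod_cat P Q) y) = f"
      by (cases x; cases y;
          auto simp: P.comp_ident_left P.comp_ident_right Q.comp_ident_left Q.comp_ident_right)+
  qed (auto simp: P.dom_in P.cod_in Q.dom_in Q.cod_in P.ident_in Q.ident_in)
qed

section \<open>Functor categories and vertical composition\<close>

lemma functor_cat_simps [simp]:
  "Obj (functor_cat S T) = {F. is_functor S T F}"
  "Arr (functor_cat S T) = {\<alpha>. is_ntrans S T \<alpha>}"
  "Dom (functor_cat S T) = src"
  "Cod (functor_cat S T) = trg"
  by (simp_all add: functor_cat_def)

lemma Hom_functor_cat [simp]:
  "\<alpha> \<in> Hom (functor_cat S T) F G \<longleftrightarrow> is_ntrans S T \<alpha> \<and> src \<alpha> = F \<and> trg \<alpha> = G"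
  by (simp add: Hom_def)

lemma functor_cat_Ident_simps [simp]:
  "src (Ident (functor_cat S T) F) = F"
  "trg (Ident (functor_cat S T) F) = F"
  "cmpt (Ident (functor_cat S T) F) = (\<lambda>x\<in>Obj S. Ident T (omap F x))"
  by (simp_all add: functor_cat_def)

lemma functor_cat_Comp_simps [simp]:
  "src (Comp (functor_cat S T) \<alpha> \<beta>) = src \<alpha>"
  "trg (Comp (functor_cat S T) \<alpha> \<beta>) = trg \<beta>"
  "cmpt (Comp (functor_cat S T) \<alpha> \<beta>) = (\<lambda>x\<in>Obj S. Comp T (cmpt \<alpha> x) (cmpt \<beta> x))"
  by (simp_all add: functor_cat_def)

text \<open>Equality here is equality of HOL records, so components must also agree off the carrier;
  extensionality provides this. The explicit type fixes the record extension to \<open>unit\<close>,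
  so that the three fields determine the value.\<close>

lemma ntrans_eqI:
  fixes \<alpha> \<beta> :: "('o1, 'a1, 'o2, 'a2) ntrans"
  assumes "src \<alpha> = src \<beta>" "trg \<alpha> = trg \<beta>"
    and "cmpt \<alpha> \<in> extensional X" "cmpt \<beta> \<in> extensional X"
    and "\<And>x. x \<in> X \<Longrightarrow> cmpt \<alpha> x = cmpt \<beta> x"
  shows "\<alpha> = \<beta>"
  using assms extensionalityI[OF assms(3-5)] by (cases \<alpha>; cases \<beta>) simp

lemma is_functorI_ntrans:
  assumes "is_ntrans S T \<alpha>"
  shows "is_functor S T (src \<alpha>)" and "is_functor S T (trg \<alpha>)"
proof -
  interpret is_ntrans S T \<alpha> by fact
  show "is_functor S T (src \<alpha>)" "is_functor S T (trg \<alpha>)"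
    by (rule src.is_functor_axioms trg.is_functor_axioms)+
qed

lemma is_ntrans_Ident:
  assumes "is_functor S T F"
  shows "is_ntrans S T (Ident (functor_cat S T) F)"
proof -
  interpret is_functor S T F by fact
  show ?thesis
  proof (intro is_ntrans.intro is_ntrans_axioms.intro)
    fix f x y assume f: "f \<in> Hom S x y"
    note S.Hom_Obj[OF f] amap_in[OF f]
    then show "Comp T (cmpt (Ident (functor_cat S T) F) x)
        (amap (trg (Ident (functor_cat S T) F)) f) =
      Comp T (amap (src (Ident (functor_cat S T) F)) f) (cmpt (Ident (functor_cat S T) F) y)"
      by (simp add: T.comp_ident_left T.comp_ident_right)
  qed (simp_all add: is_functor_axioms T.ident_in omap_in)
qed

text \<open>The naturality squares of \<alpha> and \<beta> share an edge:
  \<open>amap (trg \<alpha>) f\<close> is \<open>amap (src \<beta>) f\<close> by \<open>m\<close>.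
  Pasting the squares along it gives the naturality square of the composite.\<close>

lemma is_ntrans_Comp:
  assumes "is_ntrans S T \<alpha>" and "is_ntrans S T \<beta>" and m: "trg \<alpha> = src \<beta>"
  shows "is_ntrans S T (Comp (functor_cat S T) \<alpha> \<beta>)"
proof -
  interpret a: is_ntrans S T \<alpha> by fact
  interpret b: is_ntrans S T \<beta> by fact
  show ?thesis
  proof (intro is_ntrans.intro is_ntrans_axioms.intro)
    fix x assume "x \<in> Obj S"
    then show "cmpt (Comp (functor_cat S T) \<alpha> \<beta>) x \<in>
      Hom T (omap (src (Comp (functor_cat S T) \<alpha> \<beta>)) x)
        (omap (trg (Comp (functor_cat S T) \<alpha> \<beta>)) x)"
      using a.cmpt_in b.cmpt_in by (auto simp: m intro: a.src.T.comp_in)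
  next
    fix f x y assume f: "f \<in> Hom S x y"
    note xy = a.src.S.Hom_Obj[OF f]
    note ax = a.cmpt_in[OF xy(1)] and ay = a.cmpt_in[OF xy(2)]
    note bx = b.cmpt_in[OF xy(1)] and by' = b.cmpt_in[OF xy(2)]
    note sf = a.src.amap_in[OF f] and mf = b.src.amap_in[OF f] and tf = b.trg.amap_in[OF f]
    have "Comp T (Comp T (cmpt \<alpha> x) (cmpt \<beta> x)) (amap (trg \<beta>) f) =
        Comp T (cmpt \<alpha> x) (Comp T (amap (src \<beta>) f) (cmpt \<beta> y))"
      using a.src.T.comp_assoc[OF ax[unfolded m] bx tf] b.natural[OF f] by simp
    also have "\<dots> = Comp T (Comp T (amap (src \<alpha>) f) (cmpt \<alpha> y)) (cmpt \<beta> y)"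
      using a.src.T.comp_assoc[OF ax[unfolded m] mf by'] a.natural[OF f] m by simp
    also have "\<dots> = Comp T (amap (src \<alpha>) f) (Comp T (cmpt \<alpha> y) (cmpt \<beta> y))"
      using a.src.T.comp_assoc[OF sf ay[unfolded m] by'] .
    finally show "Comp T (cmpt (Comp (functor_cat S T) \<alpha> \<beta>) x)
        (amap (trg (Comp (functor_cat S T) \<alpha> \<beta>)) f) =
      Comp T (amap (src (Comp (functor_cat S T) \<alpha> \<beta>)) f)
        (cmpt (Comp (functor_cat S T) \<alpha> \<beta>) y)"
      using xy by simp
  qed (simp_all add: a.src.is_functor_axioms b.trg.is_functor_axioms)
qed

text \<open>The unit and associativity laws hold at each component because they hold in
  \<open>T\<close>; \<open>ntrans_eqI\<close> lifts them to equality of natural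
  transformations.\<close>

lemma category_functor_cat:
  assumes "category S" and "category T"
  shows "category (functor_cat S T)"
proof -
  interpret T: category T by fact
  show ?thesis
  proof
    fix \<alpha> F G assume \<alpha>: "\<alpha> \<in> Hom (functor_cat S T) F G"
    then interpret is_ntrans S T \<alpha> by simp
    have eq: "src \<alpha> = F" "trg \<alpha> = G" using \<alpha> by simp_all
    show "Comp (functor_cat S T) (Ident (functor_cat S T) F) \<alpha> = \<alpha>"
      using eq cmpt_ext cmpt_in
      by (intro ntrans_eqI[where X = "Obj S"]) (auto intro: T.comp_ident_left)
    show "Comp (functor_cat S T) \<alpha> (Ident (functor_cat S T) G) = \<alpha>"
      using eq cmpt_ext cmpt_in
      by (intro ntrans_eqI[where X = "Obj S"]) (auto intro: T.comp_ident_right)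
  next
    fix \<alpha> \<beta> \<gamma> F G H K
    assume a: "\<alpha> \<in> Hom (functor_cat S T) F G" and b: "\<beta> \<in> Hom (functor_cat S T) G H"
      and c: "\<gamma> \<in> Hom (functor_cat S T) H K"
    have "cmpt \<alpha> x \<in> Hom T (omap F x) (omap G x)" "cmpt \<beta> x \<in> Hom T (omap G x) (omap H x)"
      "cmpt \<gamma> x \<in> Hom T (omap H x) (omap K x)" if "x \<in> Obj S" for x
      using a b c that is_ntrans.cmpt_in by fastforce+
    then show "Comp (functor_cat S T) (Comp (functor_cat S T) \<alpha> \<beta>) \<gamma> =
        Comp (functor_cat S T) \<alpha> (Comp (functor_cat S T) \<beta> \<gamma>)"
      by (intro ntrans_eqI[where X = "Obj S"]) (auto intro: T.comp_assoc)
  qed (auto intro: is_functorI_ntrans is_ntrans_Ident is_ntrans_Comp)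
qed

section \<open>Horizontal composition\<close>

lemma functor_comp_simps [simp]:
  "omap (functor_comp S F G) = (\<lambda>x\<in>Obj S. omap G (omap F x))"
  "amap (functor_comp S F G) = (\<lambda>f\<in>Arr S. amap G (amap F f))"
  by (simp_all add: functor_comp_def)

lemma godement_simps [simp]:
  "src (godement S U \<alpha> \<beta>) = functor_comp S (src \<alpha>) (src \<beta>)"
  "trg (godement S U \<alpha> \<beta>) = functor_comp S (trg \<alpha>) (trg \<beta>)"
  "cmpt (godement S U \<alpha> \<beta>) =
    (\<lambda>x\<in>Obj S. Comp U (cmpt \<beta> (omap (src \<alpha>) x)) (amap (trg \<beta>) (cmpt \<alpha> x)))"
  by (simp_all add: godement_def)

text \<open>The laws of \<open>G\<close> are applied to images under \<open>F\<close>. As the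
  composite maps are restricted to the carriers, each arrow must first be placed in
  \<open>Arr S\<close> before its image can be evaluated.\<close>

lemma is_functor_comp:
  assumes "is_functor S T F" and "is_functor T U G"
  shows "is_functor S U (functor_comp S F G)"
proof -
  interpret F: is_functor S T F by fact
  interpret G: is_functor T U G by fact
  show ?thesis
  proof
    fix f x y assume f: "f \<in> Hom S x y"
    show "amap (functor_comp S F G) f \<in>
      Hom U (omap (functor_comp S F G) x) (omap (functor_comp S F G) y)"
      using F.S.Hom_Obj[OF f] Hom_Arr[OF f] G.amap_in[OF F.amap_in[OF f]] by simp
  next
    fix f x y g z assume f: "f \<in> Hom S x y" and g: "g \<in> Hom S y z"
    show "amap (functor_comp S F G) (Comp S f g) =
      Comp U (amap (functor_comp S F G) f) (amap (functor_comp S F G) g)"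
      using Hom_Arr[OF f] Hom_Arr[OF g] Hom_Arr[OF F.S.comp_in[OF f g]]
      by (simp add: F.amap_comp[OF f g] G.amap_comp[OF F.amap_in[OF f] F.amap_in[OF g]])
  next
    fix x assume x: "x \<in> Obj S"
    then show "amap (functor_comp S F G) (Ident S x) = Ident U (omap (functor_comp S F G) x)"
      using Hom_Arr[OF F.S.ident_in[OF x]] by (simp add: F.amap_ident G.amap_ident F.omap_in)
  qed (simp_all add: F.omap_in G.omap_in)
qed

text \<open>The required square consists of two squares side by side: naturality of \<beta> at
  \<open>amap (src \<alpha>) f\<close>, and the image under \<open>trg \<beta>\<close> of the
  naturality square of \<alpha> at \<open>f\<close>.\<close>

lemma is_ntrans_godement:
  assumes "is_ntrans S T \<alpha>" and "is_ntrans T U \<beta>"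
  shows "is_ntrans S U (godement S U \<alpha> \<beta>)"
proof -
  interpret a: is_ntrans S T \<alpha> by fact
  interpret b: is_ntrans T U \<beta> by fact
  let ?c = "\<lambda>x. Comp U (cmpt \<beta> (omap (src \<alpha>) x)) (amap (trg \<beta>) (cmpt \<alpha> x))"
  show ?thesis
  proof (intro is_ntrans.intro is_ntrans_axioms.intro)
    fix x assume x: "x \<in> Obj S"
    have "?c x \<in> Hom U (omap (src \<beta>) (omap (src \<alpha>) x)) (omap (trg \<beta>) (omap (trg \<alpha>) x))"
      using b.cmpt_in[OF a.src.omap_in[OF x]] b.trg.amap_in[OF a.cmpt_in[OF x]]
      by (rule b.src.T.comp_in)
    then show "cmpt (godement S U \<alpha> \<beta>) x \<in>
      Hom U (omap (src (godement S U \<alpha> \<beta>)) x) (omap (trg (godement S U \<alpha> \<beta>)) x)"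
      using x by simp
  next
    fix f x y assume f: "f \<in> Hom S x y"
    note xy = a.src.S.Hom_Obj[OF f]
    note ax = a.cmpt_in[OF xy(1)] and ay = a.cmpt_in[OF xy(2)]
    note sf = a.src.amap_in[OF f] and tf = a.trg.amap_in[OF f]
    note bx = b.cmpt_in[OF a.src.omap_in[OF xy(1)]]
    note by' = b.cmpt_in[OF a.src.omap_in[OF xy(2)]]
    have "Comp U (?c x) (amap (trg \<beta>) (amap (trg \<alpha>) f)) =
        Comp U (cmpt \<beta> (omap (src \<alpha>) x)) (amap (trg \<beta>) (Comp T (cmpt \<alpha> x) (amap (trg \<alpha>) f)))"
      by (simp add: b.src.T.comp_assoc[OF bx b.trg.amap_in[OF ax] b.trg.amap_in[OF tf]]
          b.trg.amap_comp[OF ax tf])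
    also have "\<dots> = Comp U (Comp U (cmpt \<beta> (omap (src \<alpha>) x)) (amap (trg \<beta>) (amap (src \<alpha>) f)))
        (amap (trg \<beta>) (cmpt \<alpha> y))"
      by (simp add: a.natural[OF f] b.trg.amap_comp[OF sf ay]
          b.src.T.comp_assoc[OF bx b.trg.amap_in[OF sf] b.trg.amap_in[OF ay]])
    also have "\<dots> = Comp U (amap (src \<beta>) (amap (src \<alpha>) f)) (?c y)"
      by (simp add: b.natural[OF sf]
          b.src.T.comp_assoc[OF b.src.amap_in[OF sf] by' b.trg.amap_in[OF ay]])
    finally show "Comp U (cmpt (godement S U \<alpha> \<beta>) x) (amap (trg (godement S U \<alpha> \<beta>)) f) =
      Comp U (amap (src (godement S U \<alpha> \<beta>)) f) (cmpt (godement S U \<alpha> \<beta>) y)"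
      using xy Hom_Arr[OF f] by simp
  qed (simp_all add: is_functor_comp[OF a.src.is_functor_axioms b.src.is_functor_axioms]
      is_functor_comp[OF a.trg.is_functor_axioms b.trg.is_functor_axioms])
qed

text \<open>Each component is an identity followed by the image under \<open>G\<close> of an
  identity, hence again an identity. This supplies preservation of identities for the composite
  \<open>get\<close>.\<close>

lemma godement_Ident:
  assumes "is_functor S T F" and "is_functor T U G"
  shows "godement S U (Ident (functor_cat S T) F) (Ident (functor_cat T U) G) =
    Ident (functor_cat S U) (functor_comp S F G)"
proof -
  interpret F: is_functor S T F by fact
  interpret G: is_functor T U G by fact
  have "Comp U (Ident U (omap G (omap F x))) (Ident U (omap G (omap F x))) =
      Ident U (omap G (omap F x))" if "x \<in> Obj S" for x
    using that by (intro G.T.comp_ident_left[OF G.T.ident_in] G.omap_in F.omap_in)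
  then show ?thesis
    by (intro ntrans_eqI[where X = "Obj S"]) (auto simp: F.omap_in G.amap_ident)
qed

text \<open>This is the interchange law between vertical and horizontal composition. It supplies
  preservation of composition for the composite \<open>get\<close>.\<close>

lemma godement_Comp:
  assumes "is_ntrans S T \<alpha>" and "is_ntrans S T \<alpha>'" and ma: "trg \<alpha> = src \<alpha>'"
    and "is_ntrans T U \<beta>" and "is_ntrans T U \<beta>'" and mb: "trg \<beta> = src \<beta>'"
  shows "godement S U (Comp (functor_cat S T) \<alpha> \<alpha>') (Comp (functor_cat T U) \<beta> \<beta>') =
    Comp (functor_cat S U) (godement S U \<alpha> \<beta>) (godement S U \<alpha>' \<beta>')"
proof -
  interpret a: is_ntrans S T \<alpha> by fact
  interpret a': is_ntrans S T \<alpha>' by fact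
  interpret b: is_ntrans T U \<beta> by fact
  interpret b': is_ntrans T U \<beta>' by fact
  have "Comp U (Comp U (cmpt \<beta> (omap (src \<alpha>) x)) (cmpt \<beta>' (omap (src \<alpha>) x)))
      (amap (trg \<beta>') (Comp T (cmpt \<alpha> x) (cmpt \<alpha>' x))) =
    Comp U (Comp U (cmpt \<beta> (omap (src \<alpha>) x)) (amap (trg \<beta>) (cmpt \<alpha> x)))
      (Comp U (cmpt \<beta>' (omap (src \<alpha>') x)) (amap (trg \<beta>') (cmpt \<alpha>' x)))"
    (is "Comp U (Comp U ?b ?b') _ = Comp U (Comp U ?b ?Ga) (Comp U ?b'' ?Ha')")
    if x: "x \<in> Obj S" for x
  proof -
    let ?Ha = "amap (trg \<beta>') (cmpt \<alpha> x)"
    note ax = a.cmpt_in[OF x, unfolded ma] and ax' = a'.cmpt_in[OF x]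
    note bx = b.cmpt_in[OF a.src.omap_in[OF x], unfolded mb]
      and bx' = b'.cmpt_in[OF a.src.omap_in[OF x]]
      and bx'' = b'.cmpt_in[OF a'.src.omap_in[OF x]]
    note Ga = b'.src.amap_in[OF ax] and Ha = b'.trg.amap_in[OF ax]
      and Ha' = b'.trg.amap_in[OF ax']
    note asc = b.src.T.comp_assoc and cin = b.src.T.comp_in
    have "Comp U (Comp U ?b ?b') (amap (trg \<beta>') (Comp T (cmpt \<alpha> x) (cmpt \<alpha>' x))) =
        Comp U ?b (Comp U (Comp U ?b' ?Ha) ?Ha')"
      by (simp add: b'.trg.amap_comp[OF ax ax'] asc[OF bx bx' cin[OF Ha Ha']]
          asc[OF bx' Ha Ha'])
    \<comment> \<open>Apart from this step, only associativity, functoriality and the match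
      \<open>mb\<close> are used. The two sides of the interchange law traverse opposite paths of
      the naturality square of \<open>\<beta>'\<close> at the arrow
      \<open>cmpt \<alpha> x\<close>.\<close>
    also have "Comp U ?b' ?Ha = Comp U (amap (src \<beta>') (cmpt \<alpha> x)) ?b''"
      by (rule b'.natural[OF ax])
    also have "Comp U ?b (Comp U (Comp U (amap (src \<beta>') (cmpt \<alpha> x)) ?b'') ?Ha') =
        Comp U (Comp U ?b ?Ga) (Comp U ?b'' ?Ha')"
      by (simp add: mb asc[OF Ga bx'' Ha'] asc[OF bx Ga cin[OF bx'' Ha']])
    finally show ?thesis .
  qed
  then show ?thesis
    by (intro ntrans_eqI[where X = "Obj S"]) (auto simp: a.src.omap_in)
qed

section \<open>Sequential composition of lenses\<close>

lemma seq_lens_simps [simp]: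
  "omap (get (seq_lens A C P Q k l)) =
    (\<lambda>(p, q) \<in> Obj P \<times> Obj Q. functor_comp A (get_at k p) (get_at l q))"
  "amap (get (seq_lens A C P Q k l)) =
    (\<lambda>(e, h) \<in> Arr P \<times> Arr Q. godement A C (get_along k e) (get_along l h))"
  "put_upd (seq_lens A C P Q k l) (p, q) X w =
    (put_upd k p X (put_req l q (omap (get_at k p) X) w), put_upd l q (omap (get_at k p) X) w)"
  "put_req (seq_lens A C P Q k l) (p, q) X w =
    put_req k p X (put_req l q (omap (get_at k p) X) w)"
  "put_self (seq_lens A C P Q k l) (p, q) X w =
    Comp C (put_self l q (omap (get_at k p) X) w)
      (amap (get_at l (Cod Q (put_upd l q (omap (get_at k p) X) w)))
        (put_self k p X (put_req l q (omap (get_at k p) X) w)))"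
  by (simp_all add: seq_lens_def Let_def)

section \<open>Typing facts for a single lens\<close>

context ala_lens
begin

lemma get_at_functor: "p \<in> Obj P \<Longrightarrow> is_functor S T (get_at l p)"
  using get.omap_in by simp

lemma get_along_ntrans:
  assumes "e \<in> Hom P p p'"
  shows "is_ntrans S T (get_along l e)"
    and "src (get_along l e) = get_at l p" and "trg (get_along l e) = get_at l p'"
  using get.amap_in[OF assms] by simp_all

text \<open>The lens axioms describe the results of \<open>put\<close> through \<open>Dom\<close>
  and \<open>Cod\<close>. Naming the new parameter and the new source object turns them into three
  \<open>Hom\<close> typings that can be fed directly to the composition rules.\<close>

lemma put_in:
  assumes p: "p \<in> Obj P" and X: "X \<in> Obj S" and v: "v \<in> Hom T (omap (get_at l p) X) Y"
  obtains p' X' where "put_upd l p X v \<in> Hom P p p'" and "put_req l p X v \<in> Hom S X X'"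
    and "put_self l p X v \<in> Hom T Y (omap (get_at l p') X')"
proof -
  note v' = Hom_Arr[OF v] Hom_Dom[OF v]
  show thesis
    using that put_upd_in[OF p X v'] put_req_in[OF p X v'] put_self_in[OF p X v']
    by (simp add: Hom_def Hom_Cod[OF v])
qed

end

text \<open>Identities and composites in the product category are componentwise and both
  \<open>get\<close> functors preserve them, so functoriality reduces to
  \<open>godement_Ident\<close> and \<open>godement_Comp\<close>.\<close>

lemma is_functor_seq_get:
  assumes "ala_lens A B P k" and "ala_lens B C Q l"
  shows "is_functor (prod_cat P Q) (functor_cat A C) (get (seq_lens A C P Q k l))"
proof -
  interpret k: ala_lens A B P k by fact
  interpret l: ala_lens B C Q l by fact
  interpret PQ: category "prod_cat P Q"
    by (intro category_prod_cat k.P.category_axioms l.P.category_axioms)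
  interpret AC: category "functor_cat A C"
    by (intro category_functor_cat k.S.category_axioms l.T.category_axioms)
  let ?G = "get (seq_lens A C P Q k l)"
  show ?thesis
  proof
    fix r assume "r \<in> Obj (prod_cat P Q)"
    then obtain p q where r: "r = (p, q)" and p: "p \<in> Obj P" and q: "q \<in> Obj Q" by auto
    note F = k.get_at_functor[OF p] and G = l.get_at_functor[OF q]
    show "omap ?G r \<in> Obj (functor_cat A C)"
      using is_functor_comp[OF F G] p q by (simp add: r)
    show "amap ?G (Ident (prod_cat P Q) r) = Ident (functor_cat A C) (omap ?G r)"
      using godement_Ident[OF F G] p q Hom_Arr[OF k.P.ident_in[OF p]] Hom_Arr[OF l.P.ident_in[OF q]]
      by (simp add: r k.get.amap_ident l.get.amap_ident)
  next
    fix d r s assume "d \<in> Hom (prod_cat P Q) r s"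
    then obtain e h p q p' q' where d: "d = (e, h)" "r = (p, q)" "s = (p', q')"
      and e: "e \<in> Hom P p p'" and h: "h \<in> Hom Q q q'"
      by (cases d; cases r; cases s) auto
    note k.P.Hom_Obj[OF e] l.P.Hom_Obj[OF h] Hom_Arr[OF e] Hom_Arr[OF h]
      k.get_along_ntrans[OF e] l.get_along_ntrans[OF h]
    then show "amap ?G d \<in> Hom (functor_cat A C) (omap ?G r) (omap ?G s)"
      by (simp add: d is_ntrans_godement)
  next
    fix d r s d' t assume "d \<in> Hom (prod_cat P Q) r s" "d' \<in> Hom (prod_cat P Q) s t"
    then obtain e h e' h' p q p' q' p'' q''
      where d: "d = (e, h)" "d' = (e', h')" "r = (p, q)" "s = (p', q')" "t = (p'', q'')"
      and e: "e \<in> Hom P p p'" and h: "h \<in> Hom Q q q'"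
      and e': "e' \<in> Hom P p' p''" and h': "h' \<in> Hom Q q' q''"
      by (cases d; cases d'; cases r; cases s; cases t) auto
    note ke = k.get_along_ntrans[OF e] k.get_along_ntrans[OF e']
    note lh = l.get_along_ntrans[OF h] l.get_along_ntrans[OF h']
    note arr = Hom_Arr[OF e] Hom_Arr[OF e'] Hom_Arr[OF h] Hom_Arr[OF h']
      Hom_Arr[OF k.P.comp_in[OF e e']] Hom_Arr[OF l.P.comp_in[OF h h']]
    show "amap ?G (Comp (prod_cat P Q) d d') =
        Comp (functor_cat A C) (amap ?G d) (amap ?G d')"
      using ke lh arr
      by (simp add: d k.get.amap_comp[OF e e'] l.get.amap_comp[OF h h'] godement_Comp)
  qed simp_all
qed

text \<open>An update travels backwards: \<open>l\<close> answers \<open>w\<close> with a request on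
  the intermediate object, and that request is the update put into \<open>k\<close>. Both answers
  are typed by \<open>put_in\<close>.\<close>

lemma ala_lens_seq:
  assumes "ala_lens A B P k" and "ala_lens B C Q l"
  shows "ala_lens A C (prod_cat P Q) (seq_lens A C P Q k l)"
proof -
  interpret k: ala_lens A B P k by fact
  interpret l: ala_lens B C Q l by fact
  interpret G: is_functor "prod_cat P Q" "functor_cat A C" "get (seq_lens A C P Q k l)"
    using assms by (rule is_functor_seq_get)
  let ?m = "seq_lens A C P Q k l"
  \<comment> \<open>The three typing axioms are proved as one conjunction because they rest on the
    same intermediate arrows.\<close>
  have "put_upd ?m r X w \<in> Arr (prod_cat P Q) \<and> Dom (prod_cat P Q) (put_upd ?m r X w) = r \<and>
    put_req ?m r X w \<in> Arr A \<and> Dom A (put_req ?m r X w) = X \<and>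
    put_self ?m r X w \<in> Hom C (Cod C w) (omap (get_at ?m (Cod (prod_cat P Q) (put_upd ?m r X w)))
      (Cod A (put_req ?m r X w)))"
    if r: "r \<in> Obj (prod_cat P Q)" and X: "X \<in> Obj A" and w: "w \<in> Arr C"
      and dom: "Dom C w = omap (get_at ?m r) X" for r X w
  proof -
    obtain p q where pq: "r = (p, q)" and p: "p \<in> Obj P" and q: "q \<in> Obj Q" using r by auto
    define Y where "Y = omap (get_at k p) X"
    have Y: "Y \<in> Obj B"
      unfolding Y_def by (rule is_functor.omap_in[OF k.get_at_functor[OF p] X])
    have w': "w \<in> Hom C (omap (get_at l q) Y) (Cod C w)"
      using w dom p q X by (simp add: HomI pq Y_def)
    obtain q' Y' where h: "put_upd l q Y w \<in> Hom Q q q'" and v: "put_req l q Y w \<in> Hom B Y Y'"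
      and ws: "put_self l q Y w \<in> Hom C (Cod C w) (omap (get_at l q') Y')"
      by (rule l.put_in[OF q Y w'])
    obtain p' X' where e: "put_upd k p X (put_req l q Y w) \<in> Hom P p p'"
      and u: "put_req k p X (put_req l q Y w) \<in> Hom A X X'"
      and vs: "put_self k p X (put_req l q Y w) \<in> Hom B Y' (omap (get_at k p') X')"
      by (rule k.put_in[OF p X v[unfolded Y_def], folded Y_def])
    note q' = l.P.Hom_Obj(2)[OF h] and p' = k.P.Hom_Obj(2)[OF e] and X' = k.S.Hom_Obj(2)[OF u]
    \<comment> \<open>The amendments meet at \<open>get_q'(Y')\<close>: that of \<open>w\<close>
      ends there, and the image under \<open>get_q'\<close> of the amendment of the request starts
      there and ends at \<open>get_q'(get_p'(X'))\<close>.\<close>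
    note l.T.comp_in[OF ws is_functor.amap_in[OF l.get_at_functor[OF q'] vs]]
    then show ?thesis
      using e h u p' q' X' by (simp add: pq flip: Y_def) (simp add: Hom_def)
  qed
  then show ?thesis
    by (intro ala_lens.intro ala_lens_axioms.intro k.S.category_axioms l.T.category_axioms
        G.S.category_axioms G.is_functor_axioms) blast+
qed

section \<open>Stability and Putget for the composite lens\<close>

lemma well_behaved_ala_lens_seq:
  assumes "well_behaved_ala_lens A B P k" and "well_behaved_ala_lens B C Q l"
  shows "well_behaved_ala_lens A C (prod_cat P Q) (seq_lens A C P Q k l)"
proof -
  interpret k: well_behaved_ala_lens A B P k by fact
  interpret l: well_behaved_ala_lens B C Q l by fact
  let ?m = "seq_lens A C P Q k l"
  interpret m: ala_lens A C "prod_cat P Q" ?m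
    by (rule ala_lens_seq[OF k.ala_lens_axioms l.ala_lens_axioms])
  show ?thesis
  proof
    fix r X assume r: "r \<in> Obj (prod_cat P Q)" and X: "X \<in> Obj A"
    then obtain p q where pq: "r = (p, q)" and p: "p \<in> Obj P" and q: "q \<in> Obj Q" by auto
    interpret F: is_functor A B "get_at k p" by (rule k.get_at_functor[OF p])
    interpret G: is_functor B C "get_at l q" by (rule l.get_at_functor[OF q])
    note Y = F.omap_in[OF X]
    \<comment> \<open>Stability passes through in sequence: on an identity, \<open>l\<close>
      requests the identity of \<open>get_p(X)\<close>, which is exactly the input to which
      stability of \<open>k\<close> applies.\<close>
    note st = p q X l.stability_upd[OF q Y] l.stability_req[OF q Y] l.stability_self[OF q Y]
      k.stability_upd[OF p X] k.stability_req[OF p X] k.stability_self[OF p X]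
    show "put_upd ?m r X (Ident C (omap (get_at ?m r) X)) = Ident (prod_cat P Q) r"
      and "put_req ?m r X (Ident C (omap (get_at ?m r) X)) = Ident A X"
      using st by (simp_all add: pq)
    show "put_self ?m r X (Ident C (omap (get_at ?m r) X)) = Ident C (omap (get_at ?m r) X)"
      \<comment> \<open>The update of \<open>q\<close> is an identity, so its codomain is
        \<open>q\<close> itself and the composite amendment is an identity followed by
        \<open>get_q\<close> of an identity.\<close>
      using st Hom_Cod[OF l.P.ident_in[OF q]] G.amap_ident[OF Y]
        l.T.comp_ident_left[OF l.T.ident_in[OF G.omap_in[OF Y]]]
      by (simp add: pq)
  next
    fix r X w assume r: "r \<in> Obj (prod_cat P Q)" and X: "X \<in> Obj A" and w: "w \<in> Arr C"
      and dom: "Dom C w = omap (get_at ?m r) X"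
    obtain p q where pq: "r = (p, q)" and p: "p \<in> Obj P" and q: "q \<in> Obj Q" using r by auto
    define Y where "Y = omap (get_at k p) X"
    have Y: "Y \<in> Obj B"
      unfolding Y_def by (rule is_functor.omap_in[OF k.get_at_functor[OF p] X])
    have w': "w \<in> Hom C (omap (get_at l q) Y) (Cod C w)"
      using w dom p q X by (simp add: HomI pq Y_def)
    define h v w_at where "h = put_upd l q Y w" and "v = put_req l q Y w"
      and "w_at = put_self l q Y w"
    define e u v_at where "e = put_upd k p X v" and "u = put_req k p X v"
      and "v_at = put_self k p X v"
    note defs = h_def v_def w_at_def e_def u_def v_at_def
    obtain q' Y' where h: "h \<in> Hom Q q q'" and v: "v \<in> Hom B Y Y'"
      and ws: "w_at \<in> Hom C (Cod C w) (omap (get_at l q') Y')"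
      unfolding h_def v_def w_at_def by (rule l.put_in[OF q Y w'])
    obtain p' X' where e: "e \<in> Hom P p p'" and u: "u \<in> Hom A X X'"
      and vs: "v_at \<in> Hom B Y' (omap (get_at k p') X')"
      unfolding e_def u_def v_at_def by (rule k.put_in[OF p X v[unfolded Y_def]])
    note q' = l.P.Hom_Obj(2)[OF h] and p' = k.P.Hom_Obj(2)[OF e] and X' = k.S.Hom_Obj(2)[OF u]
    interpret F: is_functor A B "get_at k p'" by (rule k.get_at_functor[OF p'])
    interpret G: is_functor B C "get_at l q'" by (rule l.get_at_functor[OF q'])
    note ke = k.get_along_ntrans[OF e] and lh = l.get_along_ntrans[OF h]
    have eX: "cmpt (get_along k e) X \<in> Hom B Y (omap (get_at k p') X)"
      using is_ntrans.cmpt_in[OF ke(1) X] by (simp add: ke Y_def)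
    have hY: "cmpt (get_along l h) Y \<in> Hom C (omap (get_at l q) Y) (omap (get_at l q') Y)"
      using is_ntrans.cmpt_in[OF lh(1) Y] by (simp add: lh)
    note Fu = F.amap_in[OF u]
    \<comment> \<open>Putget of \<open>k\<close> is used at the request \<open>v\<close> issued by
      \<open>l\<close>, while Putget of \<open>l\<close> is used at the original update
      \<open>w\<close>.\<close>
    have putget_k: "Comp B (cmpt (get_along k e) X) (amap (get_at k p') u) = Comp B v v_at"
      using k.putget[OF p X Hom_Arr[OF v] Hom_Dom[OF v, unfolded Y_def], folded defs]
      by (simp add: get_arr_def Hom_Cod[OF e] Hom_Dom[OF u])
    have putget_l: "Comp C (cmpt (get_along l h) Y) (amap (get_at l q') v) = Comp C w w_at"
      using l.putget[OF q Y Hom_Arr[OF w'] Hom_Dom[OF w'], folded defs]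
      by (simp add: get_arr_def Hom_Cod[OF h] Hom_Dom[OF v])
    \<comment> \<open>The left side is the Godement component at \<open>X\<close> followed by
      \<open>get_q'(get_p'(u))\<close>. Regrouping collects everything coming from \<open>k\<close>
      under a single application of \<open>get_q'\<close>.\<close>
    have "Comp C (Comp C (cmpt (get_along l h) Y) (amap (get_at l q') (cmpt (get_along k e) X)))
        (amap (get_at l q') (amap (get_at k p') u)) =
      Comp C (cmpt (get_along l h) Y)
        (amap (get_at l q') (Comp B (cmpt (get_along k e) X) (amap (get_at k p') u)))"
      by (simp add: l.T.comp_assoc[OF hY G.amap_in[OF eX] G.amap_in[OF Fu]]
          G.amap_comp[OF eX Fu])
    \<comment> \<open>Inside \<open>get_q'\<close>, Putget of \<open>k\<close> replaces the
      composite by \<open>v\<close> followed by \<open>v_at\<close>. Splitting it again exposes the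
      left side of Putget for \<open>l\<close>.\<close>
    also have "\<dots> = Comp C (Comp C (cmpt (get_along l h) Y) (amap (get_at l q') v))
        (amap (get_at l q') v_at)"
      by (simp add: putget_k G.amap_comp[OF v vs]
          l.T.comp_assoc[OF hY G.amap_in[OF v] G.amap_in[OF vs]])
    also have "\<dots> = Comp C w (Comp C w_at (amap (get_at l q') v_at))"
      by (simp add: putget_l l.T.comp_assoc[OF w' ws G.amap_in[OF vs]])
    finally have main: "Comp C (Comp C (cmpt (get_along l h) Y)
        (amap (get_at l q') (cmpt (get_along k e) X)))
        (amap (get_at l q') (amap (get_at k p') u)) =
      Comp C w (Comp C w_at (amap (get_at l q') v_at))" .
    have put: "put_upd ?m r X w = (e, h)" "put_req ?m r X w = u"
      "put_self ?m r X w = Comp C w_at (amap (get_at l q') v_at)"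
      using Hom_Cod[OF h] by (simp_all add: pq defs Y_def)
    \<comment> \<open>Since \<open>u\<close> starts at \<open>X\<close> and \<open>(e, h)\<close>
      ends at \<open>(p', q')\<close>, evaluating \<open>get_arr\<close> for the composite lens
      yields the left side of \<open>main\<close>.\<close>
    show "get_arr A C (prod_cat P Q) ?m (put_upd ?m r X w) (put_req ?m r X w) =
        Comp C w (put_self ?m r X w)"
      unfolding put get_arr_def
      using main p' q' X Hom_Arr[OF e] Hom_Arr[OF h] Hom_Arr[OF u]
      by (simp add: Hom_Dom[OF u] Hom_Cod[OF e] Hom_Cod[OF h] ke lh flip: Y_def)
  qed
qed

text \<open>Sequential composition is defined for arbitrary ala-lenses, so the typing claim stands
  outside the implication about well-behavedness.\<close>

theorem theorem1:
  fixes A :: "('ao, 'aa) cat" and B :: "('bo, 'ba) cat" and C :: "('co, 'ca) cat"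
    and P :: "('po, 'pa) cat" and Q :: "('qo, 'qa) cat"
    and k :: "('ao, 'aa, 'bo, 'ba, 'po, 'pa) lens"
    and l :: "('bo, 'ba, 'co, 'ca, 'qo, 'qa) lens"
  assumes "category A" and "category B" and "category C"
    and "category P" and "category Q"
    and "ala_lens A B P k" and "ala_lens B C Q l"
  shows "ala_lens A C (prod_cat P Q) (seq_lens A C P Q k l) \<and>
    (well_behaved_ala_lens A B P k \<and> well_behaved_ala_lens B C Q l \<longrightarrow>
      well_behaved_ala_lens A C (prod_cat P Q) (seq_lens A C P Q k l))"
  using ala_lens_seq[OF assms(6,7)] well_behaved_ala_lens_seq by blast

end
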